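(* Let $d\ge 1$, let $s\in\mathbb R^d$ be a vector with positive entries, and let $*:\mathbb R^d\times\mathbb R^d\to\mathbb R^d$ be a bilinear map with nonnegative coefficients, with growth function $g(n)$ and growth rate $\lambda=\lim_{n\to\infty}\sqrt[n]{g(n)}$. Let $r,r'\ge 0$ and $a,a'>0$ be real numbers such that $a\,n^{-r}\lambda^n\le g(n)\le a'\,n^{r'}\lambda^n$ for every integer $n\ge 1$. Then for any $n\ge 1$, \[ \sqrt[n]{\frac{1}{a'}\,n^{-r'}g(n)}\ \le\ \lambda\ \le\ \sqrt[n]{\frac1a\,n^{r}g(n)} . \]
   Context: The map $*$ has the form $(x*y)_k=\sum_{i,j}c^{(k)}_{i,j}x_iy_j$ with all $c^{(k)}_{i,j}\ge 0$, where $x_i$ denotes the $i$-th entry of a vector $x$. Define $A_1=\{s\}$ and, for $n\ge 2$, $A_n=\bigcup_{1\le m\le n-1}\{x*y: x\in A_m,\ y\in A_{n-m}\}$. Define $g(n)=\max\{v_i: v\in A_n,\ 1\le i\le d\}$. It is known that the limit $\lambda=\lim_{n\to\infty}\sqrt[n]{g(n)}$ exists for positive $s$ and nonnegative coefficients. *)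

theory Defs
  imports "HOL-Analysis.Analysis"
begin

definition nonneg_bilinear :: "(real^'d \<Rightarrow> real^'d \<Rightarrow> real^'d) \<Rightarrow> bool" where
  "nonneg_bilinear f \<longleftrightarrow>
     (\<exists>c :: 'd \<Rightarrow> 'd \<Rightarrow> 'd \<Rightarrow> real.
        (\<forall>k i j. c k i j \<ge> 0) \<and>
        (\<forall>x y k. f x y $ k = (\<Sum>i\<in>UNIV. \<Sum>j\<in>UNIV. c k i j * x $ i * y $ j)))"

lemma nonneg_bilinear_imp_bilinear:
  assumes "nonneg_bilinear f"
  shows "bilinear f"
proof -
  obtain c where c: "\<And>x y k. f x y $ k = (\<Sum>i\<in>UNIV. \<Sum>j\<in>UNIV. c k i j * x $ i * y $ j)"
    using assms unfolding nonneg_bilinear_def by blast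
  show ?thesis
    unfolding bilinear_def
    by (auto intro!: linearI
        simp: vec_eq_iff c algebra_simps sum.distrib sum_distrib_left)
qed

text \<open>The set of all values of bracketings of \<open>n\<close> copies of \<open>s\<close> under \<open>f\<close>.
  Only \<open>n \<ge> 1\<close> is meaningful; the set is empty for \<open>n = 0\<close>.\<close>

function bracket_values ::
    "(real^'d \<Rightarrow> real^'d \<Rightarrow> real^'d) \<Rightarrow> real^'d \<Rightarrow> nat \<Rightarrow> (real^'d) set" where
  "bracket_values f s n =
     (if n = 1 then {s}
      else (\<Union>m\<in>{1..n - 1}. {f x y | x y.
              x \<in> bracket_values f s m \<and> y \<in> bracket_values f s (n - m)}))"
  by pat_completeness auto
termination
  by (relation "Wellfounded.measure (\<lambda>(f, s, n). n)") auto

declare bracket_values.simps [simp del]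

definition growth_fun ::
    "(real^'d \<Rightarrow> real^'d \<Rightarrow> real^'d) \<Rightarrow> real^'d \<Rightarrow> nat \<Rightarrow> real" where
  "growth_fun f s n = Max {v $ i | v i. v \<in> bracket_values f s n}"

text \<open>The constant \<open>lim\<close> is unspecified for divergent sequences; for \<open>s\<close> with positive
  entries and \<open>nonneg_bilinear f\<close> the limit below is known to exist.\<close>

definition growth_rate ::
    "(real^'d \<Rightarrow> real^'d \<Rightarrow> real^'d) \<Rightarrow> real^'d \<Rightarrow> real" where
  "growth_rate f s = lim (\<lambda>n. root n (growth_fun f s n))"

text \<open>The maximum is taken over a finite nonempty set for \<open>n \<ge> 1\<close>.\<close>

lemma finite_bracket_values: "finite (bracket_values f s n)"
proof (induction n rule: less_induct)
  case (less n)
  have "finite {f x y | x y. x \<in> bracket_values f s m \<and> y \<in> bracket_values f s (n - m)}"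
    if "m \<in> {1..n - 1}" for m
    using that less.IH[of m] less.IH[of "n - m"]
    by (intro finite_image_set2) auto
  then show ?case
    by (subst bracket_values.simps) auto
qed

lemma bracket_values_nonempty: "n \<ge> 1 \<Longrightarrow> bracket_values f s n \<noteq> {}"
proof (induction n rule: less_induct)
  case (less n)
  show ?case
  proof (cases "n = 1")
    case True
    then show ?thesis by (subst bracket_values.simps) simp
  next
    case False
    with less.prems less.IH[of 1] less.IH[of "n - 1"] obtain x y
      where "x \<in> bracket_values f s 1" "y \<in> bracket_values f s (n - 1)"
      by fastforce
    then have "f x y \<in> {f x y | x y. x \<in> bracket_values f s 1 \<and> y \<in> bracket_values f s (n - 1)}"
      by blast
    with False less.prems have "f x y \<in> bracket_values f s n"
      by (subst bracket_values.simps) (simp, rule bexI[of _ 1], auto)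
    then show ?thesis by blast
  qed
qed

lemma finite_entries: "finite {v $ i | v i. v \<in> bracket_values f s n}"
proof -
  have "{v $ i | v i. v \<in> bracket_values f s n}
      = (\<lambda>(v, i). v $ i) ` (bracket_values f s n \<times> UNIV)"
    by auto
  then show ?thesis
    by (simp add: finite_bracket_values)
qed

lemma entries_nonempty: "n \<ge> 1 \<Longrightarrow> {v $ i | v i. v \<in> bracket_values f s n} \<noteq> {}"
  using bracket_values_nonempty[of n f s] by auto

end

theory Submission
  imports Defs
begin

text \<open>Write \<open>g\<close> for the growth function and \<open>\<lambda>\<close> for the growth rate. Moving the factors
  \<open>a n\<^sup>-\<^sup>r\<close> and \<open>a' n\<^sup>r\<^sup>'\<close> to the other side, the assumed bounds on \<open>g n\<close> become bounds
  \<open>g n / (a' n\<^sup>r\<^sup>') \<le> \<lambda>\<^sup>n \<le> n\<^sup>r g n / a\<close>, and the claim follows by taking \<open>n\<close>-th roots.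
  For even \<open>n\<close> the root undoes the power only if \<open>\<lambda> \<ge> 0\<close>, and the bounds themselves give
  this: at \<open>n = 1\<close> the upper one reads \<open>g 1 \<le> a' \<lambda>\<close>, and \<open>g 1\<close> is the largest entry
  of \<open>s\<close>, which is positive.\<close>

lemma growth_fun_1_pos:
  fixes s :: "real^'d"
  assumes "\<And>i. s $ i > 0"
  shows "growth_fun f s 1 > 0"
proof -
  have "growth_fun f s 1 \<in> {v $ i | v i. v \<in> bracket_values f s 1}"
    unfolding growth_fun_def by (intro Max_in finite_entries entries_nonempty) simp
  moreover have "bracket_values f s 1 = {s}"
    by (subst bracket_values.simps) simp
  ultimately show ?thesis
    using assms by auto
qed

theorem corollary1:
  fixes s :: "real^'d"
    and f :: "real^'d \<Rightarrow> real^'d \<Rightarrow> real^'d"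
    and r r' a a' :: real
    and n :: nat
  assumes "\<And>i. s $ i > 0"
    and "nonneg_bilinear f"
    and "r \<ge> 0" and "r' \<ge> 0" and "a > 0" and "a' > 0"
    and "\<And>n :: nat. n \<ge> 1 \<Longrightarrow>
           a * real n powr (- r) * growth_rate f s ^ n \<le> growth_fun f s n \<and>
           growth_fun f s n \<le> a' * real n powr r' * growth_rate f s ^ n"
    and "n \<ge> 1"
  shows "root n (1 / a' * real n powr (- r') * growth_fun f s n) \<le> growth_rate f s \<and>
         growth_rate f s \<le> root n (1 / a * real n powr r * growth_fun f s n)"
proof -
  let ?g = "growth_fun f s" and ?L = "growth_rate f s"
  have "0 < ?g 1"
    using assms(1) by (rule growth_fun_1_pos)
  also have "?g 1 \<le> a' * ?L"
    using assms(7)[of 1] by simp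
  finally have L: "?L \<ge> 0"
    using \<open>a' > 0\<close> by (simp add: zero_less_mult_iff)
  have n: "n > 0" "real n powr r > 0" "real n powr r' > 0"
    using \<open>n \<ge> 1\<close> by auto
  have root_power: "root n (?L ^ n) = ?L"
    using n L by (simp add: real_root_power_cancel)
  have "1 / a' * real n powr (- r') * ?g n \<le> ?L ^ n"
    using assms(7)[OF \<open>n \<ge> 1\<close>] \<open>a' > 0\<close> n by (simp add: powr_minus field_simps)
  then have "root n (1 / a' * real n powr (- r') * ?g n) \<le> root n (?L ^ n)"
    using n by simp
  moreover have "?L ^ n \<le> 1 / a * real n powr r * ?g n"
    using assms(7)[OF \<open>n \<ge> 1\<close>] \<open>a > 0\<close> n by (simp add: powr_minus field_simps)
  then have "root n (?L ^ n) \<le> root n (1 / a * real n powr r * ?g n)"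
    using n by simp
  ultimately show ?thesis
    by (simp only: root_power)
qed

end
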